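(* Let $h \geq 2$ and let $B$ be a set of positive integers such that $g_{B,h}(n) \geq 1$ for all sufficiently large integers $n$ (i.e. $B$ is an asymptotic multiplicative basis of order $h$). Then the function $n \mapsto g_{B,h}(n)$ is unbounded; equivalently, $\liminf_{n\to\infty} g_{B,h}(n) \geq 1$ implies $\limsup_{n\to\infty} g_{B,h}(n) = \infty$.
   Context: For a set $B$ of positive integers and a positive integer $h$, the multiplicative representation function is $g_{B,h}(n) = \#\{(b_1,\ldots,b_h) \in B^h : b_1 \cdots b_h = n\}$, counting ordered representations. *)

theory Defs
  imports "HOL-Analysis.Analysis"
begin

text \<open>Elements of \<open>B\<^sup>h\<close> are lists of length \<open>h\<close> with entries in \<open>B\<close>.\<close>

definition mult_reps :: "nat set \<Rightarrow> nat \<Rightarrow> nat \<Rightarrow> nat list set" where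
  "mult_reps B h n = {bs. length bs = h \<and> set bs \<subseteq> B \<and> prod_list bs = n}"

definition mult_rep_fun :: "nat set \<Rightarrow> nat \<Rightarrow> nat \<Rightarrow> nat" where
  "mult_rep_fun B h n = card (mult_reps B h n)"

text \<open>The cardinality above is a genuine count: for a set of positive integers there are
  only finitely many representations.\<close>

lemma finite_mult_reps:
  assumes "0 \<notin> B"
  shows "finite (mult_reps B h n)"
proof (cases "n = 0")
  case True
  have "mult_reps B h n = {}"
    using assms True by (auto simp: mult_reps_def prod_list_zero_iff)
  then show ?thesis by simp
next
  case False
  have dvd: "x dvd prod_list bs" if "x \<in> set bs" for x :: nat and bs
    using that by (induction bs) auto
  have "mult_reps B h n \<subseteq> {bs. set bs \<subseteq> {..n} \<and> length bs = h}"
    using False by (auto simp: mult_reps_def dest!: dvd intro: dvd_imp_le)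
  then show ?thesis
    by (rule finite_subset) (simp add: finite_lists_length_eq)
qed

end

theory Submission
  imports Defs "HOL-Library.Ramsey" "HOL-Computational_Algebra.Primes"
begin

text \<open>
  By Ramsey's theorem there is an infinite set \<open>X\<close> of
  large primes such that, for every \<open>k \<le> 2m\<close>, whether a product of \<open>k\<close> primes from \<open>X\<close> lies in \<open>B\<close>
  depends on \<open>k\<close> only. Take a set \<open>S \<subseteq> X\<close> of \<open>m\<close> primes and represent its product by elements of
  \<open>B\<close>. If a factor is the product of \<open>k\<close> primes with \<open>0 < k < m\<close>, permuting \<open>S\<close> yields at least
  \<open>m choose k \<ge> m\<close> representations. Otherwise \<open>1 \<in> B\<close> and the products of \<open>m\<close> primes from \<open>X\<close> lie in
  \<open>B\<close>; then the product of \<open>2m\<close> primes splits into two such products and the same count applies.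
\<close>

section \<open>Binomial coefficients and divisors of squarefree integers\<close>

text \<open>A row of binomial coefficients increases up to its middle and is symmetric, so an
  interior entry is at least \<open>n choose 1\<close>.\<close>

lemma le_binomial:
  assumes "0 < k" "k < n"
  shows "n \<le> n choose k"
proof (cases "2 * k \<le> n")
  case True
  then show ?thesis using binomial_mono[of 1 k n] assms by simp
next
  case False
  then have "n choose 1 \<le> n choose (n - k)" using assms by (intro binomial_mono) auto
  then show ?thesis using assms binomial_symmetric[of k n] by simp
qed

lemma prime_factorization_prod_primes:
  fixes S :: "nat set"
  assumes "finite S" "\<And>p. p \<in> S \<Longrightarrow> prime p"
  shows "prime_factorization (\<Prod>S) = mset_set S"
  using assms prime_factorization_prod_mset_primes[of "mset_set S"]
  by (simp add: prod_unfold_prod_mset)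

text \<open>A product of distinct primes is squarefree: the prime factorization of \<open>b\<close>
  is a submultiset of \<open>mset_set S\<close>, so no prime occurs twice in it and \<open>b\<close>
  is the product of its set of prime factors.\<close>

lemma dvd_prod_primes:
  fixes b :: nat
  assumes "finite S" "\<And>p. p \<in> S \<Longrightarrow> prime p" "b dvd \<Prod>S"
  obtains K where "K \<subseteq> S" "b = \<Prod>K"
proof -
  have nz: "\<Prod>S \<noteq> 0" using assms(1,2) not_prime_0 by (metis prod_zero_iff)
  then have b: "b \<noteq> 0" using assms(3) by auto
  have sub: "prime_factorization b \<subseteq># mset_set S"
    using assms nz b by (metis prime_factorization_subset_iff_dvd prime_factorization_prod_primes)
  have "prime_factors b \<subseteq> S" using set_mset_mono[OF sub] assms(1) by simp
  have "prime_factorization b = mset_set (prime_factors b)"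
  proof (rule multiset_eqI)
    fix p
    have "count (prime_factorization b) p \<le> 1"
      using mset_subset_eq_count[OF sub, of p] by (cases "p \<in> S") (auto simp: assms(1))
    moreover have "count (prime_factorization b) p \<ge> 1" if "p \<in> prime_factors b"
      using that by (simp only: count_greater_eq_one_iff)
    moreover have "count (prime_factorization b) p = 0" if "p \<notin> prime_factors b"
      using that by (simp only: not_in_iff)
    ultimately show "count (prime_factorization b) p = count (mset_set (prime_factors b)) p"
      by (cases "p \<in> prime_factors b") (simp_all add: le_antisym)
  qed
  then have "prod_mset (prime_factorization b) = prod_mset (mset_set (prime_factors b))"
    by (rule arg_cong)
  then have "b = \<Prod>(prime_factors b)" using b by (simp add: prod_unfold_prod_mset)
  then show thesis using that \<open>prime_factors b \<subseteq> S\<close> by blast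
qed

section \<open>Transport of factorizations along permutations of primes\<close>

text \<open>The completely multiplicative extension of \<open>f\<close> from the primes to the
  positive integers. At 0 the prime factorization is empty by convention and the value is 1, so
  multiplicativity is only claimed for nonzero factors.\<close>

definition map_primes :: "(nat \<Rightarrow> nat) \<Rightarrow> nat \<Rightarrow> nat" where
  "map_primes f n = prod_mset (image_mset f (prime_factorization n))"

lemma map_primes_prod_list:
  assumes "0 \<notin> set bs"
  shows "map_primes f (prod_list bs) = prod_list (map (map_primes f) bs)"
  using assms
  by (induction bs)
     (auto simp: map_primes_def prime_factorization_mult prod_list_zero_iff)

lemma map_primes_prod_set:
  assumes "finite S" "\<And>p. p \<in> S \<Longrightarrow> prime p" "inj_on f S"
  shows "map_primes f (\<Prod>S) = \<Prod>(f ` S)"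
proof -
  have "map_primes f (\<Prod>S) = prod_mset (image_mset f (mset_set S))"
    using assms(1,2) by (simp only: map_primes_def prime_factorization_prod_primes)
  then show ?thesis
    using assms(3) by (simp add: prod_unfold_prod_mset image_mset_mset_set)
qed

text \<open>Since \<open>S\<close> is finite, the complements of \<open>K\<close> and
  \<open>T\<close> in \<open>S\<close> also have equal size; a bijection between them is glued to
  one from \<open>K\<close> to \<open>T\<close>.\<close>

lemma bij_betw_extend_subset:
  assumes "finite S" "K \<subseteq> S" "T \<subseteq> S" "card K = card T"
  obtains f where "bij_betw f S S" "f ` K = T"
proof -
  have fin: "finite K" "finite T" using assms finite_subset by blast+
  obtain g where g: "bij_betw g K T"
    using fin assms(4) finite_same_card_bij by blast
  obtain g' where g': "bij_betw g' (S - K) (S - T)"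
    using assms fin finite_same_card_bij[of "S - K" "S - T"] by (auto simp: card_Diff_subset)
  define f where "f x = (if x \<in> K then g x else g' x)" for x
  have "bij_betw f K T" using g by (simp add: f_def cong: bij_betw_cong)
  moreover have "bij_betw f (S - K) (S - T)"
    using g' by (subst bij_betw_cong[of _ _ g']) (auto simp: f_def)
  ultimately have "bij_betw f (K \<union> (S - K)) (T \<union> (S - T))"
    by (rule bij_betw_combine) auto
  moreover have "K \<union> (S - K) = S" "T \<union> (S - T) = S" using assms by auto
  ultimately show thesis
    using that[of f] \<open>bij_betw f K T\<close> by (simp add: bij_betw_def)
qed

section \<open>Homogeneous sets from Ramsey's theorem\<close>

definition product_homogeneous :: "nat set \<Rightarrow> nat \<Rightarrow> nat set \<Rightarrow> bool" where
  "product_homogeneous B r X \<longleftrightarrow>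
     (\<forall>K L. K \<subseteq> X \<and> L \<subseteq> X \<and> finite K \<and> finite L \<and> card K = card L \<and> card K < r
        \<longrightarrow> (\<Prod>K \<in> B \<longleftrightarrow> \<Prod>L \<in> B))"

lemma product_homogeneousD:
  assumes "product_homogeneous B r X" "K \<subseteq> X" "L \<subseteq> X" "finite K" "finite L"
    "card K = card L" "card K < r" "\<Prod>K \<in> B"
  shows "\<Prod>L \<in> B"
  using assms unfolding product_homogeneous_def by blast

text \<open>Sizes are treated one at a time: colour the \<open>r\<close>-subsets by whether their
  product lies in \<open>B\<close> and pass to an infinite monochromatic subset. Homogeneity for the
  smaller sizes is inherited by subsets.\<close>

lemma infinite_product_homogeneous_subset:
  assumes "infinite Z"
  shows "\<exists>X \<subseteq> Z. infinite X \<and> product_homogeneous B r X"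
proof (induction r)
  case 0
  show ?case using assms by (auto simp: product_homogeneous_def)
next
  case (Suc r)
  then obtain X where X: "X \<subseteq> Z" "infinite X" "product_homogeneous B r X" by blast
  have "\<exists>Y t. Y \<subseteq> X \<and> infinite Y \<and> t < 2 \<and>
    (\<forall>K. K \<subseteq> Y \<and> finite K \<and> card K = r \<longrightarrow> (if \<Prod>K \<in> B then 1 else 0) = (t :: nat))"
    using X(2) by (intro Ramsey) auto
  then obtain Y and t :: nat where Y: "Y \<subseteq> X" "infinite Y"
    "\<forall>K. K \<subseteq> Y \<and> finite K \<and> card K = r \<longrightarrow> (if \<Prod>K \<in> B then 1 else 0) = t"
    by blast
  have "product_homogeneous B (Suc r) Y"
    unfolding product_homogeneous_def
  proof (intro allI impI, elim conjE)
    fix K L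
    assume KL: "K \<subseteq> Y" "L \<subseteq> Y" "finite K" "finite L" "card K = card L" "card K < Suc r"
    show "\<Prod>K \<in> B \<longleftrightarrow> \<Prod>L \<in> B"
    proof (cases "card K = r")
      case True
      then show ?thesis using KL Y(3) by (metis zero_neq_one)
    next
      case False
      then show ?thesis using KL X(3) Y(1) unfolding product_homogeneous_def
        by (metis less_Suc_eq subset_trans)
    qed
  qed
  then show ?case using X Y by (meson subset_trans)
qed

section \<open>Many representations from one\<close>

text \<open>A permutation of \<open>S\<close> taking \<open>K\<close> to \<open>T\<close> turns
  \<open>bs\<close> into another representation of the same product, with \<open>\<Prod>T\<close> in
  the place of \<open>\<Prod>K\<close>. Hence every \<open>T\<close> of the size of \<open>K\<close>
  contributes a different representation.\<close>

lemma card_le_mult_rep_fun: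
  assumes B: "0 \<notin> B" and X: "product_homogeneous B r X"
    and S: "finite S" "S \<subseteq> X" "card S < r" "\<And>p. p \<in> S \<Longrightarrow> prime p"
    and bs: "bs \<in> mult_reps B h (\<Prod>S)"
    and K: "K \<subseteq> S" "K \<noteq> {}" "K \<noteq> S" "\<Prod>K \<in> set bs"
  shows "card S \<le> mult_rep_fun B h (\<Prod>S)"
proof -
  obtain i where i: "i < length bs" "bs ! i = \<Prod>K" using K(4) by (auto simp: in_set_conv_nth)
  have bs': "length bs = h" "set bs \<subseteq> B" "prod_list bs = \<Prod>S" using bs by (auto simp: mult_reps_def)
  have finK: "finite K" using K S finite_subset by blast
  define TT where "TT = {T. T \<subseteq> S \<and> card T = card K}"
  have "card S \<le> card TT"
    using le_binomial[of "card K" "card S"] S(1) K finK psubset_card_mono[of S K]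
    by (auto simp: TT_def n_subsets card_gt_0_iff)
  also have "card TT = card (Prod ` TT)"
  proof -
    \<comment> \<open>A set of primes is recovered from its product, so different \<open>T\<close>
      give different products.\<close>
    have "prime_factors (\<Prod>T) = T" if "T \<subseteq> S" for T :: "nat set"
    proof -
      have "finite T" using that S finite_subset by blast
      then show ?thesis using that S(4) by (subst prime_factorization_prod_primes) auto
    qed
    then have "inj_on Prod TT" unfolding TT_def by (intro inj_on_inverseI[of _ prime_factors]) auto
    then show ?thesis by (simp add: card_image)
  qed
  \<comment> \<open>Representations are told apart by their entry at the fixed position
    \<open>i\<close>; each \<open>\<Prod>T\<close> has to occur there.\<close>
  also have "\<dots> \<le> card ((\<lambda>cs. cs ! i) ` mult_reps B h (\<Prod>S))"
  proof (intro card_mono finite_imageI finite_mult_reps B subsetI)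
    fix x assume "x \<in> Prod ` TT"
    then obtain T where T: "T \<subseteq> S" "card T = card K" "x = \<Prod>T" by (auto simp: TT_def)
    obtain f where f: "bij_betw f S S" "f ` K = T"
      using bij_betw_extend_subset[of S K T] S K T by auto
    have inj: "inj_on f L" if "L \<subseteq> S" for L using f that by (meson bij_betw_def inj_on_subset)
    define cs where "cs = map (map_primes f) bs"
    \<comment> \<open>An entry divides \<open>\<Prod>S\<close>, so it is a product of primes from
      some \<open>L\<close>; its image is a product of equally many primes from \<open>X\<close>,
      and homogeneity keeps it in \<open>B\<close>.\<close>
    have "map_primes f b \<in> B" if "b \<in> set bs" for b
    proof -
      have "b dvd \<Prod>S" using that bs'(3) by (metis prod_list_dvd)
      then obtain L where L: "L \<subseteq> S" "b = \<Prod>L" using dvd_prod_primes S by metis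
      have finL: "finite L" using L S finite_subset by blast
      have "f ` L \<subseteq> S" using f L by (auto simp: bij_betw_def)
      moreover have "card L < r" using card_mono[OF S(1) L(1)] S(3) by simp
      ultimately have "\<Prod>(f ` L) \<in> B"
        using product_homogeneousD[OF X, of L "f ` L"] L S finL inj[OF L(1)] that bs'(2)
        by (auto simp: card_image)
      moreover have "map_primes f (\<Prod>L) = \<Prod>(f ` L)"
        using map_primes_prod_set[OF finL _ inj[OF L(1)]] L(1) S(4) by blast
      ultimately show ?thesis using L(2) by simp
    qed
    moreover have "prod_list cs = \<Prod>S"
    proof -
      have "0 \<notin> set bs" using B bs' by auto
      then have "prod_list cs = map_primes f (\<Prod>S)"
        unfolding cs_def using map_primes_prod_list[of bs f] bs' by simp
      also have "\<dots> = \<Prod>S" using map_primes_prod_set[of S f] S inj f by (simp add: bij_betw_def)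
      finally show ?thesis .
    qed
    ultimately have "cs \<in> mult_reps B h (\<Prod>S)" using bs' by (auto simp: mult_reps_def cs_def)
    moreover have "cs ! i = x"
      using i map_primes_prod_set[of K f] K S finK inj f T by (auto simp: cs_def)
    ultimately show "x \<in> (\<lambda>cs. cs ! i) ` mult_reps B h (\<Prod>S)" by blast
  qed
  also have "\<dots> \<le> mult_rep_fun B h (\<Prod>S)"
    unfolding mult_rep_fun_def by (intro card_image_le finite_mult_reps B)
  finally show ?thesis .
qed

section \<open>Arbitrarily large representation counts\<close>

lemma mult_rep_fun_frequently_ge:
  fixes B :: "nat set"
  assumes h: "h \<ge> 2" and B: "0 \<notin> B"
    and basis: "\<forall>\<^sub>F n in sequentially. mult_rep_fun B h n \<ge> 1"
  shows "\<exists>\<^sub>F n in sequentially. mult_rep_fun B h n \<ge> k"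
  unfolding frequently_sequentially
proof
  fix M0
  obtain M1 where M1: "\<And>n. n \<ge> M1 \<Longrightarrow> mult_rep_fun B h n \<ge> 1"
    using basis by (auto simp: eventually_sequentially)
  \<comment> \<open>Primes above \<open>M\<close> make every nonempty product pass both the
    requested bound \<open>M0\<close> and the threshold \<open>M1\<close> of the basis
    property.\<close>
  define M where "M = max M0 M1"
  \<comment> \<open>The successor makes \<open>m\<close> positive also for \<open>k = 0\<close>, so
    \<open>S\<close> is nonempty and a proper subset of \<open>U\<close>.\<close>
  define m where "m = Suc k"
  have "infinite ({p :: nat. prime p} - {..M})" using primes_infinite by (intro Diff_infinite_finite) auto
  \<comment> \<open>Homogeneity concerns sizes strictly below its parameter, so
    \<open>2 * m + 1\<close> just includes the size of \<open>U\<close>.\<close>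
  then obtain X where X: "X \<subseteq> {p. prime p} - {..M}" "infinite X" "product_homogeneous B (2 * m + 1) X"
    using infinite_product_homogeneous_subset[of _ B "2 * m + 1"] by blast
  have prime: "prime p" and gtM: "M < p" if "p \<in> X" for p using X(1) that by auto
  have large: "M \<le> \<Prod>S" if S: "finite S" "S \<subseteq> X" "S \<noteq> {}" for S
  proof -
    obtain p where p: "p \<in> S" using S by blast
    have "\<Prod>S > 0" using S(2) prime by (intro prod_pos) (metis prime_gt_0_nat subsetD)
    moreover have "p dvd \<Prod>S" using S p by (simp add: dvd_prodI[of S p "\<lambda>x. x"])
    ultimately have "p \<le> \<Prod>S" by (rule dvd_imp_le[rotated])
    then show ?thesis using gtM[of p] p S by auto
  qed
  obtain U where U: "finite U" "card U = 2 * m" "U \<subseteq> X"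
    using infinite_arbitrarily_large[OF X(2)] by blast
  obtain S where S: "S \<subseteq> U" "card S = m" "finite S"
    using obtain_subset_with_card_n[of m U] U by auto
  have SX: "S \<subseteq> X" "S \<noteq> {}" "card S < 2 * m + 1" using S U by (auto simp: m_def)
  have UX: "U \<noteq> {}" "card U < 2 * m + 1" using U by (auto simp: m_def)
  have "mult_reps B h (\<Prod>S) \<noteq> {}"
    using M1[of "\<Prod>S"] large[of S] SX S by (auto simp: M_def mult_rep_fun_def)
  then obtain bs where bs: "bs \<in> mult_reps B h (\<Prod>S)" by blast
  then have bs': "length bs = h" "set bs \<subseteq> B" "prod_list bs = \<Prod>S" by (auto simp: mult_reps_def)
  have factor: "\<exists>K\<subseteq>S. b = \<Prod>K" if "b \<in> set bs" for b
    using dvd_prod_primes[of S b] that bs'(3) S SX prime by (metis prod_list_dvd subsetD)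
  show "\<exists>n\<ge>M0. k \<le> mult_rep_fun B h n"
  proof (cases "\<exists>K\<subseteq>S. K \<noteq> {} \<and> K \<noteq> S \<and> \<Prod>K \<in> set bs")
    case True
    then obtain K where K: "K \<subseteq> S" "K \<noteq> {}" "K \<noteq> S" "\<Prod>K \<in> set bs" by blast
    have "card S \<le> mult_rep_fun B h (\<Prod>S)"
      using card_le_mult_rep_fun[OF B X(3) S(3) SX(1,3) _ bs K] prime SX by blast
    then show ?thesis using large[of S] S SX by (intro exI[of _ "\<Prod>S"]) (auto simp: M_def m_def)
  next
    case False
    then have trivial: "b = 1 \<or> b = \<Prod>S" if b: "b \<in> set bs" for b
    proof -
      obtain K where K: "K \<subseteq> S" "b = \<Prod>K" using factor[OF b] by blast
      then have "K = {} \<or> K = S" using False b by blast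
      then show ?thesis using K(2) by auto
    qed
    have "\<Prod>S > 1"
    proof -
      obtain p where "p \<in> S" using SX by blast
      then have "p dvd \<Prod>S" "prime p" using S SX prime by (auto simp: dvd_prodI[of S p "\<lambda>x. x"])
      moreover have "\<Prod>S > 0" using SX(1) prime by (intro prod_pos) (metis prime_gt_0_nat subsetD)
      ultimately show ?thesis by (metis dvd_imp_le less_le_trans prime_gt_1_nat)
    qed
    obtain a b cs where abcs: "bs = a # b # cs"
      using bs'(1) h by (cases bs; cases "tl bs") auto
    have "\<Prod>S \<in> set bs"
    proof (rule ccontr)
      assume "\<Prod>S \<notin> set bs"
      then have "\<forall>b\<in>set bs. b = 1" using trivial by auto
      then have "prod_list bs = 1" by (induction bs) auto
      then show False using bs'(3) \<open>\<Prod>S > 1\<close> by simp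
    qed
    then have SB: "\<Prod>S \<in> B" using bs' by auto
    \<comment> \<open>Here \<open>h \<ge> 2\<close> enters: without an entry 1, the first two
      entries would both be \<open>\<Prod>S\<close>, and its square would divide it.\<close>
    have "1 \<in> set bs"
    proof (rule ccontr)
      assume "1 \<notin> set bs"
      then have "a = \<Prod>S" "b = \<Prod>S" using trivial abcs by auto
      then have "\<Prod>S * (\<Prod>S * prod_list cs) = \<Prod>S" using bs'(3) abcs by simp
      then show False using \<open>\<Prod>S > 1\<close> by simp
    qed
    then have oneB: "1 \<in> B" using bs' by auto
    have US: "U - S \<subseteq> X" "card (U - S) = m" "finite (U - S)"
      using U S by (auto simp: card_Diff_subset)
    have "\<Prod>(U - S) \<in> B"
      using product_homogeneousD[OF X(3) SX(1) US(1) S(3) US(3)] S US SB SX by simp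
    moreover have "\<Prod>S * \<Prod>(U - S) = \<Prod>U"
      using prod.subset_diff[OF S(1) U(1), of "\<lambda>x. x"] by (simp add: mult.commute)
    \<comment> \<open>Padding with ones from \<open>B\<close> gives length \<open>h\<close>. The
      entry \<open>\<Prod>S\<close> is now a nontrivial factor, which was impossible for the product
      of \<open>S\<close> alone.\<close>
    ultimately have rep: "\<Prod>S # \<Prod>(U - S) # replicate (h - 2) 1 \<in> mult_reps B h (\<Prod>U)"
      using h SB oneB by (auto simp: mult_reps_def)
    have "S \<noteq> U" using S(2) U(2) by (auto simp: m_def)
    then have "card U \<le> mult_rep_fun B h (\<Prod>U)"
      using card_le_mult_rep_fun[OF B X(3) U(1,3) UX(2) _ rep S(1) SX(2)] prime U(3) by auto
    then show ?thesis using large[of U] U UX by (intro exI[of _ "\<Prod>U"]) (auto simp: M_def m_def)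
  qed
qed

theorem theorem5:
  fixes h :: nat and B :: "nat set"
  assumes "h \<ge> 2" and "\<And>b. b \<in> B \<Longrightarrow> b > 0"
  shows "((\<forall>\<^sub>F n in sequentially. mult_rep_fun B h n \<ge> 1) \<longrightarrow>
            \<not> bdd_above (mult_rep_fun B h ` {0<..})) \<and>
         (liminf (\<lambda>n. ereal (real (mult_rep_fun B h n))) \<ge> 1 \<longrightarrow>
            limsup (\<lambda>n. ereal (real (mult_rep_fun B h n))) = \<infinity>)"
proof (intro conjI impI)
  have B: "0 \<notin> B" using assms(2) by blast
  show "\<not> bdd_above (mult_rep_fun B h ` {0<..})"
    if ev: "\<forall>\<^sub>F n in sequentially. mult_rep_fun B h n \<ge> 1"
  proof
    assume "bdd_above (mult_rep_fun B h ` {0<..})"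
    then obtain C where C: "\<And>n. n > 0 \<Longrightarrow> mult_rep_fun B h n \<le> C" by (auto simp: bdd_above_def)
    obtain n where "n \<ge> 1" "mult_rep_fun B h n \<ge> Suc C"
      using mult_rep_fun_frequently_ge[OF assms(1) B ev, of "Suc C"]
      by (auto simp: frequently_sequentially)
    then show False using C[of n] by simp
  qed
  show "limsup (\<lambda>n. ereal (real (mult_rep_fun B h n))) = \<infinity>"
    if li: "liminf (\<lambda>n. ereal (real (mult_rep_fun B h n))) \<ge> 1"
  proof (rule ccontr)
    \<comment> \<open>A lower limit only yields eventual bounds strictly below it; eventual
      positivity suffices because the counts are integers.\<close>
    have "0 < liminf (\<lambda>n. ereal (real (mult_rep_fun B h n)))"
      using li by (rule less_le_trans[rotated]) simp
    then have "\<forall>\<^sub>F n in sequentially. ereal (real (mult_rep_fun B h n)) > 0" by (rule less_LiminfD)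
    then have ev: "\<forall>\<^sub>F n in sequentially. mult_rep_fun B h n \<ge> 1"
      by eventually_elim simp
    assume "limsup (\<lambda>n. ereal (real (mult_rep_fun B h n))) \<noteq> \<infinity>"
    then obtain C where "limsup (\<lambda>n. ereal (real (mult_rep_fun B h n))) < ereal (real C)"
      using less_PInf_Ex_of_nat by auto
    then have "\<forall>\<^sub>F n in sequentially. ereal (real (mult_rep_fun B h n)) < ereal (real C)"
      by (rule Limsup_lessD)
    then have "\<forall>\<^sub>F n in sequentially. \<not> mult_rep_fun B h n \<ge> C"
      by eventually_elim simp
    then show False
      using mult_rep_fun_frequently_ge[OF assms(1) B ev, of C] by (simp add: frequently_def)
  qed
qed

end
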